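(* Let $\nu$ be a non-degenerate compactly supported probability measure on $\mathbb{R}$ with mean $m_0(\nu)=\int x\,\nu(dx)=0$, and let $\mathcal{K}(\nu)$ be the Cauchy-Stieltjes kernel (CSK) family generated by $\nu$. Then there exists a family of $\nu$-orthogonal polynomials $(T_n)_{n\in\mathbb{N}}$ (with $T_n$ of degree $n$) having a Cauchy-Stieltjes type kernel generating function if and only if $\mathcal{K}(\nu)$ is quadratic.
   Context: Let $\nu$ be a non-degenerate (not a point mass) compactly supported probability measure on $\mathbb{R}$ with mean $0$. Put $B=\max\{0,\sup\operatorname{supp}\nu\}$, $A=\min\{0,\inf\operatorname{supp}\nu\}$ (so $A<0<B$), $\theta_+=1/B$, $\theta_-=1/A$. For $\theta\in(\theta_-,\theta_+)$ let $$M_\nu(\theta)=\int\frac{1}{1-\theta x}\,\nu(dx),\qquad P_\theta(dx)=\frac{1}{M_\nu(\theta)(1-\theta x)}\,\nu(dx),\qquad k_\nu(\theta)=\int x\,P_\theta(dx).$$ The function $k_\nu$ is strictly increasing on $(\theta_-,\theta_+)$ with $k_\nu(0)=0$; its image is the open interval $(m_-,m_+)$ (the domain of means), and $\psi_\nu:(m_-,m_+)\to(\theta_-,\theta_+)$ denotes its inverse. The two-sided CSK family is $\mathcal{K}(\nu)=\{P_\theta:\theta\in(\theta_-,\theta_+)\}=\{Q_m:m\in(m_-,m_+)\}$, $Q_m=P_{\psi_\nu(m)}$ (so $Q_0=\nu$). Its variance function is $V_\nu(m)=\int(x-m)^2\,Q_m(dx)$, $m\in(m_-,m_+)$. The family $\mathcal{K}(\nu)$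 is called quadratic if $V_\nu$ is, on $(m_-,m_+)$, a polynomial in $m$ of degree at most $2$. A sequence of polynomials $(T_n)_{n\in\mathbb{N}}$ ($\mathbb{N}$ includes $0$) is $\nu$-orthogonal if $\int T_nT_k\,d\nu=0$ for all $n\neq k$. The generating function of $(T_n)$ is given by a Cauchy-Stieltjes type kernel if $$\sum_{n\in\mathbb{N}}T_n(x)z^n=\frac{1}{u(z)[f(z)-x]},$$ where $u$ and $z\mapsto zf(z)$ are real analytic functions around $0$ with $\lim_{z\to0}\frac{u(z)}{z}=\lim_{z\to0}zf(z)=1$. The equality is understood for every real $x$ and all sufficiently small $z\neq 0$ (depending on $x$); equivalently, as an identity of power series in $z$ at $0$. *)

theory Defs
  imports "HOL-Probability.Probability" "HOL-Computational_Algebra.Polynomial"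
begin

definition msupport :: "real measure \<Rightarrow> real set" where
  "msupport \<nu> = {x. \<forall>U. open U \<longrightarrow> x \<in> U \<longrightarrow> emeasure \<nu> U > 0}"

definition nondegenerate :: "real measure \<Rightarrow> bool" where
  "nondegenerate \<nu> \<longleftrightarrow> (\<forall>a. \<nu> \<noteq> return borel a)"

text \<open>
  \<open>Sup\<close> and \<open>Inf\<close> below are those of the reals, so these two constants are meaningful only for
  measures whose support is nonempty and bounded.
\<close>

definition csk_B :: "real measure \<Rightarrow> real" where
  "csk_B \<nu> = max 0 (Sup (msupport \<nu>))"

definition csk_A :: "real measure \<Rightarrow> real" where
  "csk_A \<nu> = min 0 (Inf (msupport \<nu>))"

text \<open>
  The parameter interval \<open>(1/A, 1/B)\<close>; \<open>A < 0 < B\<close> holds for a non-degenerate, compactly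
  supported law of mean zero.
\<close>

definition csk_params :: "real measure \<Rightarrow> real set" where
  "csk_params \<nu> = {1 / csk_A \<nu> <..< 1 / csk_B \<nu>}"

definition csk_M :: "real measure \<Rightarrow> real \<Rightarrow> real" where
  "csk_M \<nu> \<theta> = (\<integral>x. 1 / (1 - \<theta> * x) \<partial>\<nu>)"

definition csk_P :: "real measure \<Rightarrow> real \<Rightarrow> real measure" where
  "csk_P \<nu> \<theta> = density \<nu> (\<lambda>x. ennreal (1 / (csk_M \<nu> \<theta> * (1 - \<theta> * x))))"

definition csk_k :: "real measure \<Rightarrow> real \<Rightarrow> real" where
  "csk_k \<nu> \<theta> = (\<integral>x. x \<partial>(csk_P \<nu> \<theta>))"

text \<open>The domain of means \<open>(m\<^sub>-, m\<^sub>+)\<close>, taken as the image of the mean function.\<close>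

definition csk_means :: "real measure \<Rightarrow> real set" where
  "csk_means \<nu> = csk_k \<nu> ` csk_params \<nu>"

definition csk_psi :: "real measure \<Rightarrow> real \<Rightarrow> real" where
  "csk_psi \<nu> = the_inv_into (csk_params \<nu>) (csk_k \<nu>)"

definition csk_Q :: "real measure \<Rightarrow> real \<Rightarrow> real measure" where
  "csk_Q \<nu> m = csk_P \<nu> (csk_psi \<nu> m)"

definition csk_V :: "real measure \<Rightarrow> real \<Rightarrow> real" where
  "csk_V \<nu> m = (\<integral>x. (x - m)\<^sup>2 \<partial>(csk_Q \<nu> m))"

definition csk_quadratic :: "real measure \<Rightarrow> bool" where
  "csk_quadratic \<nu> \<longleftrightarrow>
     (\<exists>p :: real poly. degree p \<le> 2 \<and> (\<forall>m \<in> csk_means \<nu>. csk_V \<nu> m = poly p m))"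

definition orthogonal_polys :: "real measure \<Rightarrow> (nat \<Rightarrow> real poly) \<Rightarrow> bool" where
  "orthogonal_polys \<nu> T \<longleftrightarrow>
     (\<forall>n k. n \<noteq> k \<longrightarrow> (\<integral>x. poly (T n) x * poly (T k) x \<partial>\<nu>) = 0)"

text \<open>Equal, on a neighbourhood of 0 (including 0), to the sum of a convergent power series.\<close>

definition real_analytic_at_0 :: "(real \<Rightarrow> real) \<Rightarrow> bool" where
  "real_analytic_at_0 g \<longleftrightarrow> (\<exists>G. g has_fps_expansion G)"

text \<open>
  The function \<open>f\<close> has a pole at 0, so its value there is immaterial: analyticity of
  \<open>z \<mapsto> z * f z\<close> is that of the function extended to 0 by its limit 1.
\<close>

definition cs_kernel_genfun :: "(nat \<Rightarrow> real poly) \<Rightarrow> bool" where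
  "cs_kernel_genfun T \<longleftrightarrow>
     (\<exists>u f :: real \<Rightarrow> real.
        real_analytic_at_0 u \<and>
        real_analytic_at_0 (\<lambda>z. if z = 0 then 1 else z * f z) \<and>
        ((\<lambda>z. u z / z) \<longlongrightarrow> 1) (at 0) \<and>
        ((\<lambda>z. z * f z) \<longlongrightarrow> 1) (at 0) \<and>
        (\<forall>x. \<forall>\<^sub>F z in at 0. (\<lambda>n. poly (T n) x * z ^ n) sums (1 / (u z * (f z - x)))))"

end

theory Submission
  imports Defs
begin

text \<open>
  Write \<open>m\<^sub>j(\<theta>) = \<integral> x\<^sup>j / (1 - \<theta> x) d\<nu>\<close>. Then \<open>k = m\<^sub>1 / m\<^sub>0\<close> and \<open>V(k) = m\<^sub>2 / m\<^sub>0 - k\<^sup>2\<close>, so \<open>V\<close> is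
  quadratic iff \<open>m\<^sub>0 m\<^sub>2 = p\<^sub>0 m\<^sub>0\<^sup>2 + p\<^sub>1 m\<^sub>0 m\<^sub>1 + q m\<^sub>1\<^sup>2\<close> for some constants. By analyticity this
  is an identity between the moment series \<open>\<Sum>k. (\<integral> x\<^bsup>j+k\<^esup> d\<nu>) \<theta>\<^sup>k\<close>. With \<open>w = 1 / f\<close> and \<open>G = u f\<close> the
  kernel is \<open>1 / (G (1 - w x))\<close>; integrating against \<open>x\<^sup>j\<close> gives
  \<open>\<Sum>n. (\<integral> x\<^sup>j T\<^sub>n d\<nu>) z\<^sup>n = m\<^sub>j(w(z)) / G(z)\<close>, and orthogonality says that this is a polynomial of
  degree at most \<open>j\<close> in \<open>z\<close>. For \<open>j \<le> 2\<close> that yields the quadratic relation. Conversely, the relation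
  determines \<open>1 / f = w = z / (1 + p\<^sub>1 z + q p\<^sub>0 z\<^sup>2)\<close>, and then \<open>z P\<^bsub>j+1\<^esub> = (z / w) P\<^sub>j - m\<^sub>j(0) z / u\<close>
  with \<open>P\<^sub>j = m\<^sub>j(w) / G\<close> bounds the degrees.
\<close>

unbundle no vec_syntax and fps_syntax

section \<open>Real power series expansions\<close>

text \<open>Dividing \<open>f\<close> by \<open>z ^ subdegree F\<close> leaves a function whose
  limit at 0 is the nonzero leading coefficient, which is impossible if \<open>f\<close> vanishes
  near 0.\<close>

lemma has_fps_expansion_zero_unique:
  fixes F :: "real fps"
  assumes "f has_fps_expansion F" and "\<forall>\<^sub>F z in nhds 0. f z = 0"
  shows "F = 0"
proof (rule ccontr)
  assume "F \<noteq> 0"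
  define c where "c = F $ subdegree F"
  have "c \<noteq> 0"
    using \<open>F \<noteq> 0\<close> by (simp add: c_def)
  let ?g = "\<lambda>z. if z = 0 then c else f z / z ^ subdegree F"
  have "?g has_fps_expansion fps_shift (subdegree F) F"
    using assms(1) by (rule has_fps_expansion_shift) (auto simp: c_def)
  then have "(?g \<longlongrightarrow> c) (at 0)"
    using has_fps_expansion_imp_continuous[of ?g _ UNIV] by (simp add: continuous_within)
  moreover have "(?g \<longlongrightarrow> 0) (at 0)"
    by (rule tendsto_eventually)
      (use assms(2) in \<open>auto simp: eventually_at_filter elim: eventually_mono\<close>)
  ultimately show False
    using \<open>c \<noteq> 0\<close> tendsto_unique trivial_limit_at by blast
qed

lemma has_fps_expansion_unique:
  fixes F G :: "real fps"
  assumes "f has_fps_expansion F" and "g has_fps_expansion G"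
    and "\<forall>\<^sub>F z in nhds 0. f z = g z"
  shows "F = G"
proof -
  have "F - G = 0"
    by (rule has_fps_expansion_zero_unique[OF has_fps_expansion_diff[OF assms(1,2)]])
      (use assms(3) in \<open>auto elim: eventually_mono\<close>)
  then show ?thesis by simp
qed

lemma has_fps_expansion_imp_sums:
  fixes F :: "real fps"
  assumes "f has_fps_expansion F"
  shows "\<forall>\<^sub>F z in nhds 0. (\<lambda>n. F $ n * z ^ n) sums f z"
proof -
  have "\<forall>\<^sub>F z in nhds (0::real). z \<in> eball 0 (fps_conv_radius F)"
    using assms by (intro eventually_nhds_in_open) (auto simp: has_fps_expansion_def zero_ereal_def)
  moreover have "\<forall>\<^sub>F z in nhds 0. eval_fps F z = f z"
    using assms by (auto simp: has_fps_expansion_def)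
  ultimately show ?thesis
  proof eventually_elim
    case (elim z)
    then have "summable (\<lambda>n. F $ n * z ^ n)"
      by (intro summable_fps) auto
    then show ?case
      using elim by (auto simp: eval_fps_def dest: summable_sums)
  qed
qed

text \<open>Convergence at one nonzero point already gives a positive radius. The second claim is
  punctured because the hypothesis says nothing about \<open>f 0\<close>.\<close>

lemma sums_imp_has_fps_expansion:
  fixes a :: "nat \<Rightarrow> real"
  assumes "\<forall>\<^sub>F z in at 0. (\<lambda>n. a n * z ^ n) sums f z"
  shows "eval_fps (Abs_fps a) has_fps_expansion Abs_fps a"
    and "\<forall>\<^sub>F z in at 0. eval_fps (Abs_fps a) z = f z"
proof -
  obtain z :: real where z: "z \<noteq> 0" "(\<lambda>n. a n * z ^ n) sums f z"
    using eventually_happens[OF eventually_conj[OF assms eventually_neq_at_within[of 0 0 UNIV]]]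
    by auto
  have "0 < ereal (norm z)"
    using z by simp
  also have "\<dots> \<le> fps_conv_radius (Abs_fps a)"
    unfolding fps_conv_radius_def
    by (rule conv_radius_geI) (use z in \<open>auto simp: sums_iff\<close>)
  finally show "eval_fps (Abs_fps a) has_fps_expansion Abs_fps a"
    by (rule eval_fps_has_fps_expansion)
  show "\<forall>\<^sub>F z in at 0. eval_fps (Abs_fps a) z = f z"
    using assms by eventually_elim (simp add: eval_fps_def sums_iff)
qed

text \<open>Unlike \<open>has_fps_expansion\<close>, which only sees a germ at 0, this fixes the
  interval of agreement; the moment identity is needed on the whole parameter interval.\<close>

definition expands_on :: "real \<Rightarrow> (real \<Rightarrow> real) \<Rightarrow> real fps \<Rightarrow> bool" where
  "expands_on \<rho> f F \<longleftrightarrow>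
     ereal \<rho> \<le> fps_conv_radius F \<and> (\<forall>t. \<bar>t\<bar> < \<rho> \<longrightarrow> eval_fps F t = f t)"

lemma expands_on_radius: "expands_on \<rho> f F \<Longrightarrow> \<bar>t\<bar> < \<rho> \<Longrightarrow> ereal (norm t) < fps_conv_radius F"
  unfolding expands_on_def by (metis ereal_less_eq(3) less_ereal.simps(1) order_less_le_trans real_norm_def)

lemma expands_on_const: "expands_on \<rho> (\<lambda>_. c) (fps_const c)"
  by (simp add: expands_on_def)

lemma expands_on_mult:
  assumes "expands_on \<rho> f F" and "expands_on \<rho> g G"
  shows "expands_on \<rho> (\<lambda>t. f t * g t) (F * G)"
  using assms expands_on_radius[OF assms(1)] expands_on_radius[OF assms(2)]
    order_trans[OF _ fps_conv_radius_mult[of F G]]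
  by (auto simp: expands_on_def eval_fps_mult)

lemma expands_on_add:
  assumes "expands_on \<rho> f F" and "expands_on \<rho> g G"
  shows "expands_on \<rho> (\<lambda>t. f t + g t) (F + G)"
  using assms expands_on_radius[OF assms(1)] expands_on_radius[OF assms(2)]
    order_trans[OF _ fps_conv_radius_add[of F G]]
  by (auto simp: expands_on_def eval_fps_add)

lemma expands_on_diff:
  assumes "expands_on \<rho> f F" and "expands_on \<rho> g G"
  shows "expands_on \<rho> (\<lambda>t. f t - g t) (F - G)"
  using assms expands_on_radius[OF assms(1)] expands_on_radius[OF assms(2)]
    order_trans[OF _ fps_conv_radius_diff[of F G]]
  by (auto simp: expands_on_def eval_fps_diff)

lemma expands_on_imp_has_fps_expansion:
  assumes "expands_on \<rho> f F" and "0 < \<rho>"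
  shows "f has_fps_expansion F"
proof -
  have "0 < ereal \<rho>"
    using assms(2) by simp
  also have "\<dots> \<le> fps_conv_radius F"
    using assms(1) by (simp add: expands_on_def)
  finally have "0 < fps_conv_radius F" .
  moreover have "\<forall>\<^sub>F t in nhds 0. t \<in> {- \<rho> <..< \<rho>}"
    using assms(2) by (intro eventually_nhds_in_open) auto
  then have "\<forall>\<^sub>F t in nhds 0. eval_fps F t = f t"
    by eventually_elim (use assms(1) in \<open>auto simp: expands_on_def\<close>)
  ultimately show ?thesis
    by (simp add: has_fps_expansion_def)
qed

section \<open>Compactly supported laws\<close>

text \<open>The complement of the support is a possibly uncountable union of open null sets; the
  Lindelof property reduces it to a countable one.\<close>

lemma (in real_distribution) AE_in_msupport: "AE x in M. x \<in> msupport M"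
proof -
  define \<F> where "\<F> = {U::real set. open U \<and> emeasure M U = 0}"
  obtain \<F>' where F': "\<F>' \<subseteq> \<F>" "countable \<F>'" "\<Union>\<F>' = \<Union>\<F>"
    using Lindelof[of \<F>] by (auto simp: \<F>_def)
  have "\<Union>\<F>' \<in> null_sets M"
  proof -
    have "U \<in> null_sets M" if "U \<in> \<F>'" for U
      using that F'(1) by (auto simp: \<F>_def null_sets_def)
    then show ?thesis
      using null_sets_UN'[OF F'(2), of "\<lambda>U. U" M] by simp
  qed
  moreover have "- msupport M = \<Union>\<F>"
    by (auto simp: msupport_def \<F>_def not_less)
  ultimately show ?thesis
    using F'(3) by (intro AE_I'[of "\<Union>\<F>"]) auto
qed

lemma (in real_distribution) eq_return:
  assumes "AE x in M. x = a"
  shows "M = return borel a"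
proof (rule measure_eqI)
  show "sets M = sets (return borel a)" by simp
  fix S assume S: "S \<in> sets M"
  have "emeasure M S = (\<integral>\<^sup>+x. indicator S x \<partial>M)"
    using S by simp
  also have "\<dots> = (\<integral>\<^sup>+x. indicator S a \<partial>M)"
    by (rule nn_integral_cong_AE) (use assms in auto)
  also have "\<dots> = emeasure (return borel a) S"
    using S emeasure_space_1 by simp
  finally show "emeasure M S = emeasure (return borel a) S" .
qed

text \<open>Replaces the support by an interval \<open>{A..B}\<close> carrying the mass, and
  non-degeneracy by its almost-everywhere form, the shapes that the integral arguments
  consume.\<close>

locale csk_law = real_distribution \<nu> for \<nu> :: "real measure" +
  fixes A B :: real
  assumes A_neg: "A < 0" and B_pos: "0 < B"
    and AE_Icc: "AE x in \<nu>. x \<in> {A..B}"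
    and mean_zero: "(\<integral>x. x \<partial>\<nu>) = 0"
    and not_AE_const: "\<not> (AE x in \<nu>. x = a)"
    and params_eq: "csk_params \<nu> = {1 / A <..< 1 / B}"

lemma csk_law_of_compact_msupport:
  assumes "real_distribution \<nu>"
    and "compact (msupport \<nu>)"
    and "nondegenerate \<nu>"
    and "(\<integral>x. x \<partial>\<nu>) = 0"
  shows "csk_law \<nu> (csk_A \<nu>) (csk_B \<nu>)"
proof -
  interpret real_distribution \<nu> by fact
  have nc: "\<not> (AE x in \<nu>. x = a)" for a
    using assms(3) eq_return by (auto simp: nondegenerate_def)
  have bdd: "bdd_above (msupport \<nu>)" "bdd_below (msupport \<nu>)"
    using assms(2) by (auto intro: bounded_imp_bdd_above bounded_imp_bdd_below compact_imp_bounded)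
  have AB: "csk_A \<nu> \<le> x \<and> x \<le> csk_B \<nu>" if "x \<in> msupport \<nu>" for x
    using that bdd cSup_upper[of x "msupport \<nu>"] cInf_lower[of x "msupport \<nu>"]
    by (auto simp: csk_A_def csk_B_def min_def max_def)
  have AE: "AE x in \<nu>. x \<in> {csk_A \<nu>..csk_B \<nu>}"
    using AE_in_msupport by eventually_elim (use AB in auto)
  have "AE x in \<nu>. norm x \<le> max (- csk_A \<nu>) (csk_B \<nu>)"
    using AE by eventually_elim auto
  then have int: "integrable \<nu> (\<lambda>x. x)"
    by (rule integrable_const_bound) simp
  \<comment> \<open>A mean-zero law living on one side of 0 would be the point mass at 0.\<close>
  have "csk_A \<nu> \<noteq> 0"
  proof
    assume "csk_A \<nu> = 0"
    then have "AE x in \<nu>. 0 \<le> x"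
      using AE by auto
    then have "AE x in \<nu>. x = 0"
      using integral_nonneg_eq_0_iff_AE[OF int] assms(4) by simp
    with nc show False by blast
  qed
  moreover have "csk_B \<nu> \<noteq> 0"
  proof
    assume "csk_B \<nu> = 0"
    then have "AE x in \<nu>. 0 \<le> - x"
      using AE by auto
    then have "AE x in \<nu>. - x = 0"
      using integral_nonneg_eq_0_iff_AE[of \<nu> "\<lambda>x. - x"] int assms(4) by simp
    with nc[of 0] show False by simp
  qed
  moreover have "csk_A \<nu> \<le> 0" "0 \<le> csk_B \<nu>"
    by (simp_all add: csk_A_def csk_B_def)
  ultimately have neg: "csk_A \<nu> < 0" and pos: "0 < csk_B \<nu>"
    by linarith+
  show ?thesis
    by unfold_locales (fact neg pos AE assms(4) nc csk_params_def)+
qed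

section \<open>Means and variances of the Cauchy-Stieltjes kernel family\<close>

context csk_law
begin

lemma integrable_continuous:
  assumes "continuous_on {A..B} g" and "g \<in> borel_measurable borel"
  shows "integrable \<nu> (g :: real \<Rightarrow> real)"
proof -
  obtain K where K: "\<And>x. x \<in> {A..B} \<Longrightarrow> norm (g x) \<le> K"
    using compact_imp_bounded[OF compact_continuous_image[OF assms(1) compact_Icc]]
    unfolding bounded_iff by blast
  show ?thesis
  proof (rule integrable_const_bound[of _ K])
    show "AE x in \<nu>. norm (g x) \<le> K"
      using AE_Icc by eventually_elim (rule K)
    show "g \<in> borel_measurable \<nu>"
      using assms(2) by simp
  qed
qed

text \<open>\<open>\<theta> * x\<close> is linear in \<open>x\<close>, hence at most its larger
  endpoint value, and the choice of the parameter interval keeps both endpoint values below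
  1.\<close>

lemma denom_pos:
  assumes "\<theta> \<in> csk_params \<nu>" and "x \<in> {A..B}"
  shows "0 < 1 - \<theta> * x"
proof -
  have "\<theta> * A < 1" "\<theta> * B < 1"
    using assms(1) A_neg B_pos by (auto simp: params_eq field_simps)
  moreover have "\<theta> * x \<le> max (\<theta> * A) (\<theta> * B)"
  proof (cases "0 \<le> \<theta>")
    case True
    then have "\<theta> * x \<le> \<theta> * B"
      using assms(2) by (intro mult_left_mono) auto
    then show ?thesis by simp
  next
    case False
    then have "\<theta> * x \<le> \<theta> * A"
      using assms(2) by (intro mult_left_mono_neg) auto
    then show ?thesis by simp
  qed
  ultimately show ?thesis by linarith
qed

lemma zero_in_params: "0 \<in> csk_params \<nu>"
  using A_neg B_pos by (simp add: params_eq)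

lemma eventually_params: "\<forall>\<^sub>F \<theta> in nhds 0. \<theta> \<in> csk_params \<nu>"
  by (rule eventually_nhds_in_open) (use zero_in_params in \<open>auto simp: params_eq\<close>)

lemma integrable_cauchy:
  assumes "\<theta> \<in> csk_params \<nu>" and "continuous_on UNIV g"
  shows "integrable \<nu> (\<lambda>x. g x / (1 - \<theta> * x))"
proof (rule integrable_continuous)
  have "continuous_on {A..B} g"
    using assms(2) continuous_on_subset by blast
  then show "continuous_on {A..B} (\<lambda>x. g x / (1 - \<theta> * x))"
    using denom_pos[OF assms(1)] by (intro continuous_intros) force+
  have [measurable]: "g \<in> borel_measurable borel"
    using assms(2) by (rule borel_measurable_continuous_onI)
  show "(\<lambda>x. g x / (1 - \<theta> * x)) \<in> borel_measurable borel"
    by measurable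
qed

definition cauchy_moment :: "nat \<Rightarrow> real \<Rightarrow> real" where
  "cauchy_moment j \<theta> = (\<integral>x. x ^ j / (1 - \<theta> * x) \<partial>\<nu>)"

lemma csk_M_eq: "csk_M \<nu> \<theta> = cauchy_moment 0 \<theta>"
  by (simp add: csk_M_def cauchy_moment_def)

lemma csk_M_pos:
  assumes "\<theta> \<in> csk_params \<nu>"
  shows "0 < csk_M \<nu> \<theta>"
proof -
  have int: "integrable \<nu> (\<lambda>x. 1 / (1 - \<theta> * x))"
    using integrable_cauchy[OF assms, of "\<lambda>_. 1"] by simp
  have nn: "AE x in \<nu>. 0 < 1 / (1 - \<theta> * x)"
    using AE_Icc by eventually_elim (use denom_pos[OF assms] in auto)
  have "csk_M \<nu> \<theta> \<noteq> 0"
  proof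
    assume "csk_M \<nu> \<theta> = 0"
    moreover have "AE x in \<nu>. 0 \<le> 1 / (1 - \<theta> * x)"
      using nn by eventually_elim simp
    ultimately have "AE x in \<nu>. 1 / (1 - \<theta> * x) = 0"
      unfolding csk_M_def using integral_nonneg_eq_0_iff_AE[OF int] by blast
    \<comment> \<open>The integrand would be both zero and positive, so any almost-everywhere claim
      follows; this one is refuted by \<open>not_AE_const\<close>.\<close>
    then have "AE x in \<nu>. x = 0"
      using nn by eventually_elim simp
    with not_AE_const show False by blast
  qed
  moreover have "0 \<le> csk_M \<nu> \<theta>"
    unfolding csk_M_def by (rule integral_nonneg_AE) (use nn in eventually_elim, auto)
  ultimately show ?thesis by simp
qed

lemma integral_csk_P:
  fixes g :: "real \<Rightarrow> real"
  assumes "\<theta> \<in> csk_params \<nu>" and [measurable]: "g \<in> borel_measurable borel"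
  shows "(\<integral>x. g x \<partial>csk_P \<nu> \<theta>) = (\<integral>x. g x / (1 - \<theta> * x) \<partial>\<nu>) / csk_M \<nu> \<theta>"
proof -
  have "AE x in \<nu>. 0 \<le> 1 / (csk_M \<nu> \<theta> * (1 - \<theta> * x))"
    using AE_Icc by eventually_elim
      (use denom_pos[OF assms(1)] csk_M_pos[OF assms(1)] in \<open>auto intro!: mult_nonneg_nonneg less_imp_le\<close>)
  then have "(\<integral>x. g x \<partial>csk_P \<nu> \<theta>)
      = (\<integral>x. (1 / (csk_M \<nu> \<theta> * (1 - \<theta> * x))) *\<^sub>R g x \<partial>\<nu>)"
    unfolding csk_P_def by (intro integral_density) auto
  also have "\<dots> = (\<integral>x. (g x / (1 - \<theta> * x)) / csk_M \<nu> \<theta> \<partial>\<nu>)"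
    by (intro Bochner_Integration.integral_cong) auto
  also have "\<dots> = (\<integral>x. g x / (1 - \<theta> * x) \<partial>\<nu>) / csk_M \<nu> \<theta>"
    by (rule integral_divide_zero)
  finally show ?thesis .
qed

lemma csk_k_eq:
  "\<theta> \<in> csk_params \<nu> \<Longrightarrow> csk_k \<nu> \<theta> = cauchy_moment 1 \<theta> / cauchy_moment 0 \<theta>"
  by (simp add: csk_k_def integral_csk_P csk_M_eq) (simp add: cauchy_moment_def)

text \<open>
  If \<open>P\<^sub>\<theta>\<close> and \<open>P\<^sub>\<phi>\<close> have the same mean \<open>m\<close>, then \<open>x - m\<close> integrates to zero against
  \<open>1 / (1 - \<theta> x)\<close> and \<open>1 / (1 - \<phi> x)\<close>; a linear combination of these two kernels is
  \<open>(x - m) / ((1 - \<theta> x) (1 - \<phi> x))\<close>, so \<open>x = m\<close> almost everywhere.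
\<close>

lemma inj_on_csk_k: "inj_on (csk_k \<nu>) (csk_params \<nu>)"
proof (rule inj_onI, rule ccontr)
  fix \<theta> \<phi>
  assume \<theta>: "\<theta> \<in> csk_params \<nu>" and \<phi>: "\<phi> \<in> csk_params \<nu>"
    and eq: "csk_k \<nu> \<theta> = csk_k \<nu> \<phi>" and "\<theta> \<noteq> \<phi>"
  define m where "m = csk_k \<nu> \<theta>"
  have centred: "(\<integral>x. (x - m) / (1 - t * x) \<partial>\<nu>) = 0"
    if "t \<in> csk_params \<nu>" "csk_k \<nu> t = m" for t
  proof -
    have "(\<integral>x. (x - m) / (1 - t * x) \<partial>\<nu>)
        = (\<integral>x. x / (1 - t * x) - m / (1 - t * x) \<partial>\<nu>)"
      by (simp add: diff_divide_distrib)
    also have "\<dots> = (\<integral>x. x / (1 - t * x) \<partial>\<nu>) - (\<integral>x. m * (1 / (1 - t * x)) \<partial>\<nu>)"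
      using integrable_cauchy[OF that(1), of "\<lambda>x. x"] integrable_cauchy[OF that(1), of "\<lambda>_. m"]
      by (subst Bochner_Integration.integral_diff) auto
    also have "\<dots> = cauchy_moment 1 t - m * cauchy_moment 0 t"
      by (subst integral_mult_right_zero) (simp add: cauchy_moment_def)
    also have "\<dots> = 0"
      using that csk_k_eq[OF that(1)] csk_M_pos[OF that(1)] by (simp add: csk_M_eq field_simps)
    finally show ?thesis .
  qed
  \<comment> \<open>Comparing coefficients in
    \<open>a * (1 - \<phi> * x) + b * (1 - \<theta> * x) = x - m\<close> gives a linear system with
    this solution.\<close>
  define a b where "a = (\<theta> * m - 1) / (\<phi> - \<theta>)" and "b = (1 - \<phi> * m) / (\<phi> - \<theta>)"
  have "a * (\<phi> - \<theta>) = \<theta> * m - 1" "b * (\<phi> - \<theta>) = 1 - \<phi> * m"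
    using \<open>\<theta> \<noteq> \<phi>\<close> by (simp_all add: a_def b_def)
  then have "(a + b) * (\<phi> - \<theta>) = - m * (\<phi> - \<theta>)"
    "(a * \<phi> + b * \<theta>) * (\<phi> - \<theta>) = - 1 * (\<phi> - \<theta>)"
    by algebra+
  then have "a + b = - m" "a * \<phi> + b * \<theta> = - 1"
    using \<open>\<theta> \<noteq> \<phi>\<close> by (simp_all only: mult_right_cancel right_minus_eq)
  then have ab: "a * (1 - \<phi> * x) + b * (1 - \<theta> * x) = x - m" for x
    by algebra
  have key: "a * ((x - m) / (1 - \<theta> * x)) + b * ((x - m) / (1 - \<phi> * x))
      = (x - m)\<^sup>2 / ((1 - \<theta> * x) * (1 - \<phi> * x))" if "x \<in> {A..B}" for x
  proof -
    have "a * ((x - m) / (1 - \<theta> * x)) + b * ((x - m) / (1 - \<phi> * x))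
        = (x - m) * (a * (1 - \<phi> * x) + b * (1 - \<theta> * x)) / ((1 - \<theta> * x) * (1 - \<phi> * x))"
      using denom_pos[OF \<theta> that] denom_pos[OF \<phi> that]
      by (simp add: add_divide_distrib distrib_left mult.commute)
    then show ?thesis
      by (simp only: ab power2_eq_square)
  qed
  let ?h = "\<lambda>x. a * ((x - m) / (1 - \<theta> * x)) + b * ((x - m) / (1 - \<phi> * x))"
  have int: "integrable \<nu> (\<lambda>x. (x - m) / (1 - t * x))" if "t \<in> csk_params \<nu>" for t
    using that by (intro integrable_cauchy continuous_intros)
  have h_int: "integrable \<nu> ?h"
    by (intro Bochner_Integration.integrable_add integrable_mult_right int[OF \<theta>] int[OF \<phi>])
  have h_nonneg: "AE x in \<nu>. 0 \<le> ?h x"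
    using AE_Icc
  proof eventually_elim
    case (elim x)
    then show ?case
      unfolding key[OF elim] using denom_pos[OF \<theta> elim] denom_pos[OF \<phi> elim]
      by (intro divide_nonneg_nonneg mult_nonneg_nonneg) auto
  qed
  have "(\<integral>x. ?h x \<partial>\<nu>) = 0"
    using int[OF \<theta>] int[OF \<phi>] centred[OF \<theta> m_def[symmetric]]
      centred[OF \<phi> eq[symmetric, folded m_def]]
    by (simp only: Bochner_Integration.integral_add integrable_mult_right integral_mult_right_zero)
  then have "AE x in \<nu>. ?h x = 0"
    by (rule integral_nonneg_eq_0_iff_AE[OF h_int h_nonneg, THEN iffD1])
  then have "AE x in \<nu>. x = m"
    using AE_Icc
  proof eventually_elim
    case (elim x)
    have "(1 - \<theta> * x) * (1 - \<phi> * x) \<noteq> 0"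
      using denom_pos[OF \<theta> elim(2)] denom_pos[OF \<phi> elim(2)] by (metis less_irrefl mult_pos_pos)
    then have "(x - m)\<^sup>2 = 0"
      using elim(1) by (metis key[OF elim(2)] divide_eq_0_iff)
    then show ?case by simp
  qed
  with not_AE_const show False by (rule notE)
qed

text \<open>Injectivity gives \<open>csk_psi \<nu> (csk_k \<nu> \<theta>) = \<theta>\<close>, so the
  law with mean \<open>csk_k \<nu> \<theta>\<close> is \<open>csk_P \<nu> \<theta>\<close>; what
  remains is second moment minus squared mean.\<close>

lemma csk_V_csk_k:
  assumes "\<theta> \<in> csk_params \<nu>"
  shows "csk_V \<nu> (csk_k \<nu> \<theta>)
    = cauchy_moment 2 \<theta> / cauchy_moment 0 \<theta> - (cauchy_moment 1 \<theta> / cauchy_moment 0 \<theta>)\<^sup>2"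
proof -
  define m where "m = csk_k \<nu> \<theta>"
  have int: "integrable \<nu> (\<lambda>x. x ^ j / (1 - \<theta> * x))" for j
    by (intro integrable_cauchy assms continuous_intros)
  have "csk_V \<nu> m = (\<integral>x. (x - m)\<^sup>2 / (1 - \<theta> * x) \<partial>\<nu>) / cauchy_moment 0 \<theta>"
    unfolding csk_V_def csk_Q_def csk_psi_def m_def the_inv_into_f_f[OF inj_on_csk_k assms]
    by (simp add: integral_csk_P[OF assms] csk_M_eq)
  also have "(\<integral>x. (x - m)\<^sup>2 / (1 - \<theta> * x) \<partial>\<nu>)
      = (\<integral>x. x ^ 2 / (1 - \<theta> * x) - (2 * m) * (x ^ 1 / (1 - \<theta> * x))
          + m\<^sup>2 * (x ^ 0 / (1 - \<theta> * x)) \<partial>\<nu>)"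
    by (intro Bochner_Integration.integral_cong)
      (simp_all add: power2_diff add_divide_distrib diff_divide_distrib algebra_simps)
  also have "\<dots> = cauchy_moment 2 \<theta> - 2 * m * cauchy_moment 1 \<theta> + m\<^sup>2 * cauchy_moment 0 \<theta>"
    unfolding cauchy_moment_def using int
    by (simp only: Bochner_Integration.integral_add Bochner_Integration.integral_diff
        integral_mult_right_zero integrable_mult_right Bochner_Integration.integrable_diff)
  finally have V: "csk_V \<nu> m = \<dots> / cauchy_moment 0 \<theta>" .
  have "cauchy_moment 0 \<theta> > 0"
    using csk_M_pos[OF assms] by (simp add: csk_M_eq)
  then show ?thesis
    using V unfolding m_def csk_k_eq[OF assms]
    by (simp add: field_simps power2_eq_square)
qed

text \<open>Taylor series in \<open>t\<close> of the integral of
  \<open>x ^ j / (1 - t * (x - c))\<close>. Centre 0 gives the ordinary moments; the midpoint of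
  \<open>{A..B}\<close> makes the bound on \<open>\<bar>x - c\<bar>\<close> smallest.\<close>

definition moment_fps :: "real \<Rightarrow> nat \<Rightarrow> real fps" where
  "moment_fps c j = Abs_fps (\<lambda>k. \<integral>x. x ^ j * (x - c) ^ k \<partial>\<nu>)"

text \<open>The geometric series is integrated term by term; its terms are dominated by
  \<open>K * (\<bar>t\<bar> * R) ^ k\<close>, which is summable.\<close>

lemma moment_fps_sums:
  assumes R: "AE x in \<nu>. \<bar>x - c\<bar> \<le> R" and "0 < R" and t: "\<bar>t\<bar> < 1 / R"
  shows "(\<lambda>k. moment_fps c j $ k * t ^ k) sums (\<integral>x. x ^ j / (1 - t * (x - c)) \<partial>\<nu>)"
proof -
  define K where "K = max \<bar>A\<bar> \<bar>B\<bar> ^ j"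
  let ?f = "\<lambda>k x. x ^ j * (x - c) ^ k * t ^ k"
  have tR: "\<bar>t\<bar> * R < 1"
    using t \<open>0 < R\<close> by (simp add: field_simps)
  have int: "integrable \<nu> (?f k)" for k
    by (intro integrable_continuous continuous_intros) measurable
  have bound: "AE x in \<nu>. norm (?f k x) \<le> K * (\<bar>t\<bar> * R) ^ k" for k
    using AE_Icc R
  proof eventually_elim
    case (elim x)
    have "\<bar>x\<bar> ^ j \<le> K"
      unfolding K_def using elim by (intro power_mono) auto
    moreover have "\<bar>x - c\<bar> ^ k \<le> R ^ k"
      using elim by (intro power_mono) auto
    ultimately have "\<bar>x\<bar> ^ j * (\<bar>x - c\<bar> ^ k * \<bar>t\<bar> ^ k) \<le> K * (R ^ k * \<bar>t\<bar> ^ k)"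
      using \<open>0 < R\<close> by (intro mult_mono mult_right_mono) (auto simp: K_def)
    then show ?case
      by (simp add: abs_mult power_abs power_mult_distrib mult_ac)
  qed
  have geo: "(\<lambda>k. ?f k x) sums (x ^ j / (1 - t * (x - c)))" "summable (\<lambda>k. norm (?f k x))"
    if "\<bar>x - c\<bar> \<le> R" for x
  proof -
    have "norm (t * (x - c)) < 1"
      using that tR mult_left_mono[OF that, of "\<bar>t\<bar>"] by (simp add: abs_mult)
    from sums_mult[OF geometric_sums[OF this], of "x ^ j"]
    show "(\<lambda>k. ?f k x) sums (x ^ j / (1 - t * (x - c)))"
      by (simp add: power_mult_distrib mult_ac)
    from \<open>norm (t * (x - c)) < 1\<close> have "summable (\<lambda>k. \<bar>x\<bar> ^ j * norm (t * (x - c)) ^ k)"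
      by (intro summable_mult summable_geometric) simp
    then show "summable (\<lambda>k. norm (?f k x))"
      by (simp add: abs_mult power_abs power_mult_distrib mult_ac)
  qed
  have "(\<lambda>k. integral\<^sup>L \<nu> (?f k)) sums (\<integral>x. (\<Sum>k. ?f k x) \<partial>\<nu>)"
  proof (rule sums_integral[OF int])
    show "AE x in \<nu>. summable (\<lambda>k. norm (?f k x))"
      using R by eventually_elim (rule geo(2))
    show "summable (\<lambda>k. \<integral>x. norm (?f k x) \<partial>\<nu>)"
    proof (rule summable_comparison_test')
      show "summable (\<lambda>k. K * (\<bar>t\<bar> * R) ^ k)"
        using tR \<open>0 < R\<close> by (intro summable_mult summable_geometric) simp
      show "norm (\<integral>x. norm (?f k x) \<partial>\<nu>) \<le> K * (\<bar>t\<bar> * R) ^ k" if "0 \<le> k" for k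
        using integral_mono_AE[OF integrable_norm[OF int[of k]] integrable_const bound[of k]]
        using prob_space by simp
    qed
  qed
  also have "(\<integral>x. (\<Sum>k. ?f k x) \<partial>\<nu>) = (\<integral>x. x ^ j / (1 - t * (x - c)) \<partial>\<nu>)"
  proof (rule integral_cong_AE)
    show "AE x in \<nu>. (\<Sum>k. ?f k x) = x ^ j / (1 - t * (x - c))"
      using R by eventually_elim (simp add: sums_unique[OF geo(1)])
  qed measurable
  finally show ?thesis
    by (simp add: moment_fps_def)
qed

end

section \<open>The quadratic relation between moment series\<close>

text \<open>The variance relation with denominators cleared. It is homogeneous of degree 2, so a
  common factor of the last three arguments comes out as a square, and it makes sense for numbers
  and for series alike.\<close>

definition quad_defect :: "'a::comm_ring_1 \<Rightarrow> 'a \<Rightarrow> 'a \<Rightarrow> 'a \<Rightarrow> 'a \<Rightarrow> 'a \<Rightarrow> 'a" where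
  "quad_defect p0 p1 q a b c = a * c - (p0 * (a * a) + p1 * (a * b) + q * (b * b))"

lemma quad_defect_scale:
  "quad_defect p0 p1 q (r * a) (r * b) (r * c) = r\<^sup>2 * quad_defect p0 p1 q a b c"
  by (simp add: quad_defect_def algebra_simps power2_eq_square)

lemma expands_on_quad_defect:
  assumes "expands_on \<rho> f F" and "expands_on \<rho> g G" and "expands_on \<rho> h H"
  shows "expands_on \<rho> (\<lambda>t. quad_defect p0 p1 q (f t) (g t) (h t))
    (quad_defect (fps_const p0) (fps_const p1) (fps_const q) F G H)"
  unfolding quad_defect_def
  by (intro expands_on_diff expands_on_add expands_on_mult expands_on_const assms)

lemma quad_defect_eq_0_iff:
  fixes a :: "'a::field"
  assumes "a \<noteq> 0"
  shows "quad_defect p0 p1 q a b c = 0 \<longleftrightarrow> c / a = p0 + p1 * (b / a) + q * (b / a)\<^sup>2"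
  using assms by (simp add: quad_defect_def field_simps power2_eq_square)

context csk_law
begin

lemma expands_on_moment_fps:
  assumes "AE x in \<nu>. \<bar>x - c\<bar> \<le> R" and "0 < R"
  shows "expands_on (1 / R) (\<lambda>t. \<integral>x. x ^ j / (1 - t * (x - c)) \<partial>\<nu>) (moment_fps c j)"
proof -
  have "ereal (1 / R) \<le> fps_conv_radius (moment_fps c j)"
    unfolding fps_conv_radius_def
    by (rule conv_radius_geI_ex') (use moment_fps_sums[OF assms] in \<open>auto simp: sums_iff\<close>)
  then show ?thesis
    using moment_fps_sums[OF assms] by (auto simp: expands_on_def eval_fps_def sums_iff)
qed

abbreviation mom :: "nat \<Rightarrow> real fps" where
  "mom \<equiv> moment_fps 0"

lemma mom_nth: "mom j $ k = (\<integral>x. x ^ (j + k) \<partial>\<nu>)"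
  by (simp add: moment_fps_def power_add)

abbreviation mom_defect :: "real \<Rightarrow> real \<Rightarrow> real \<Rightarrow> real fps" where
  "mom_defect p0 p1 q \<equiv>
    quad_defect (fps_const p0) (fps_const p1) (fps_const q) (mom 0) (mom 1) (mom 2)"

abbreviation cauchy_defect :: "real \<Rightarrow> real \<Rightarrow> real \<Rightarrow> real \<Rightarrow> real" where
  "cauchy_defect p0 p1 q \<theta> \<equiv>
    quad_defect p0 p1 q (cauchy_moment 0 \<theta>) (cauchy_moment 1 \<theta>) (cauchy_moment 2 \<theta>)"

lemma cauchy_defect_expansion: "cauchy_defect p0 p1 q has_fps_expansion mom_defect p0 p1 q"
proof -
  have "0 < B - A"
    using A_neg B_pos by simp
  have "AE x in \<nu>. \<bar>x - 0\<bar> \<le> B - A"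
    using AE_Icc by eventually_elim (use A_neg B_pos in auto)
  from expands_on_moment_fps[OF this \<open>0 < B - A\<close>]
  have "expands_on (1 / (B - A)) (cauchy_moment j) (mom j)" for j
    by (simp add: cauchy_moment_def[abs_def])
  then show ?thesis
    by (intro expands_on_imp_has_fps_expansion[of "1 / (B - A)"] expands_on_quad_defect)
      (use \<open>0 < B - A\<close> in auto)
qed

text \<open>
  The Moebius substitution \<open>\<theta> = t / (1 + c t)\<close> with \<open>c = (A + B) / 2\<close> maps the disc
  \<open>\<bar>t\<bar> < 2 / (B - A)\<close> onto the parameter interval, and \<open>1 / (1 - \<theta> x) = (1 + c t) / (1 - t (x - c))\<close>
  is a single power series in \<open>t\<close> there. This replaces analytic continuation.
\<close>

lemma cauchy_defect_eq_0:
  assumes "mom_defect p0 p1 q = 0" and "\<theta> \<in> csk_params \<nu>"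
  shows "cauchy_defect p0 p1 q \<theta> = 0"
proof -
  define c R where "c = (A + B) / 2" and "R = (B - A) / 2"
  have "0 < R"
    using A_neg B_pos by (simp add: R_def)
  have R: "AE x in \<nu>. \<bar>x - c\<bar> \<le> R"
    using AE_Icc by eventually_elim (auto simp: c_def R_def abs_le_iff field_simps)
  define N where "N = (\<lambda>j t. \<integral>x. x ^ j / (1 - t * (x - c)) \<partial>\<nu>)"
  define D where "D = (\<lambda>t. quad_defect p0 p1 q (N 0 t) (N 1 t) (N 2 t))"
  define H where "H = quad_defect (fps_const p0) (fps_const p1) (fps_const q)
    (moment_fps c 0) (moment_fps c 1) (moment_fps c 2)"
  have D_H: "expands_on (1 / R) D H"
    unfolding D_def H_def N_def
    by (intro expands_on_quad_defect expands_on_moment_fps R \<open>0 < R\<close>)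
  have cauchy_N: "cauchy_moment j (t / (1 + c * t)) = (1 + c * t) * N j t"
    if "1 + c * t \<noteq> 0" for j t
  proof -
    have "1 - t / (1 + c * t) * x = (1 - t * (x - c)) / (1 + c * t)" for x
      using that by (simp add: field_simps)
    then have "cauchy_moment j (t / (1 + c * t))
        = (\<integral>x. (1 + c * t) * (x ^ j / (1 - t * (x - c))) \<partial>\<nu>)"
      unfolding cauchy_moment_def by (simp add: mult.commute)
    then show ?thesis
      by (simp only: N_def integral_mult_right_zero)
  qed
  have defect_D: "cauchy_defect p0 p1 q (t / (1 + c * t)) = (1 + c * t)\<^sup>2 * D t"
    if "1 + c * t \<noteq> 0" for t
    by (simp only: cauchy_N[OF that] quad_defect_scale D_def)
  \<comment> \<open>The vanishing series gives a zero germ in \<theta>; pulled back along the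
    substitution it kills the germ of \<open>D\<close>, hence the whole series
    \<open>H\<close>.\<close>
  have "\<forall>\<^sub>F \<phi> in nhds 0. cauchy_defect p0 p1 q \<phi> = 0"
    using cauchy_defect_expansion[of p0 p1 q] assms(1)
    by (auto simp: has_fps_expansion_def elim: eventually_mono)
  moreover have "((\<lambda>t. t / (1 + c * t)) \<longlongrightarrow> 0 / (1 + c * 0)) (nhds 0)"
    by (intro tendsto_intros filterlim_ident) simp_all
  then have "filterlim (\<lambda>t. t / (1 + c * t)) (nhds 0) (nhds 0)"
    by simp
  ultimately have "\<forall>\<^sub>F t in nhds 0. cauchy_defect p0 p1 q (t / (1 + c * t)) = 0"
    by (rule eventually_compose_filterlim)
  moreover have "\<forall>\<^sub>F t in nhds 0. 1 + c * t \<noteq> 0"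
  proof -
    have "((\<lambda>t. 1 + c * t) \<longlongrightarrow> 1 + c * 0) (nhds 0)"
      by (intro tendsto_intros filterlim_ident)
    then show ?thesis
      by (rule tendsto_imp_eventually_ne) simp
  qed
  ultimately have "\<forall>\<^sub>F t in nhds 0. D t = 0"
    by eventually_elim (use defect_D in auto)
  with expands_on_imp_has_fps_expansion[OF D_H] \<open>0 < R\<close> have "H = 0"
    by (intro has_fps_expansion_zero_unique[of D]) auto
  have D_0: "D t = 0" if "\<bar>t\<bar> < 1 / R" for t
    using D_H that unfolding \<open>H = 0\<close> expands_on_def by auto
  have pos: "0 < 1 - \<theta> * A" "0 < 1 - \<theta> * B"
    using denom_pos[OF assms(2)] A_neg B_pos by auto
  then have c_pos: "0 < 1 - c * \<theta>"
    by (simp add: c_def field_simps)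
  define t where "t = \<theta> / (1 - c * \<theta>)"
  \<comment> \<open>For \<open>\<theta> \<ge> 0\<close> this is \<open>\<theta> * B < 1\<close>,
    since \<open>c + R = B\<close>; otherwise it is \<open>\<theta> * A < 1\<close>, since
    \<open>c - R = A\<close>.\<close>
  have "\<bar>\<theta>\<bar> * R < 1 - c * \<theta>"
    using pos by (cases "0 \<le> \<theta>") (simp_all add: c_def R_def field_simps)
  then have "\<bar>t\<bar> < 1 / R"
    using c_pos \<open>0 < R\<close> by (simp add: t_def field_simps)
  have "1 + c * t = 1 / (1 - c * \<theta>)"
    using c_pos by (simp add: t_def field_simps)
  then have "1 + c * t \<noteq> 0" and "t / (1 + c * t) = \<theta>"
    using c_pos by (auto simp: t_def)
  then show ?thesis
    using defect_D[of t] D_0[OF \<open>\<bar>t\<bar> < 1 / R\<close>] by simp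
qed

text \<open>The shift \<open>coeff p 2 + 1\<close> absorbs the squared mean subtracted in the
  variance; \<open>cauchy_moment 0 \<theta>\<close> is nonzero, so denominators can be
  cleared.\<close>

lemma csk_V_poly_iff:
  assumes "\<theta> \<in> csk_params \<nu>" and "degree p \<le> 2"
  shows "csk_V \<nu> (csk_k \<nu> \<theta>) = poly p (csk_k \<nu> \<theta>)
    \<longleftrightarrow> cauchy_defect (coeff p 0) (coeff p 1) (coeff p 2 + 1) \<theta> = 0"
proof -
  have poly_p: "poly p y = coeff p 0 + coeff p 1 * y + coeff p 2 * y\<^sup>2" for y
  proof -
    have "p = [:coeff p 0, coeff p 1, coeff p 2:]"
      by (rule poly_eqI)
        (use assms(2) in \<open>auto simp: coeff_pCons numeral_2_eq_2 split: nat.split intro!: coeff_eq_0\<close>)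
    then have "poly p y = poly [:coeff p 0, coeff p 1, coeff p 2:] y"
      by simp
    then show ?thesis
      by (simp add: algebra_simps power2_eq_square)
  qed
  have nz: "cauchy_moment 0 \<theta> \<noteq> 0"
    using csk_M_pos[OF assms(1)] by (simp add: csk_M_eq)
  show ?thesis
    unfolding csk_V_csk_k[OF assms(1)]
    unfolding quad_defect_eq_0_iff[OF nz] poly_p csk_k_eq[OF assms(1)]
    by (simp add: algebra_simps)
qed

text \<open>Left to right, the relation near 0 already forces the series to vanish; right to left,
  \<open>cauchy_defect_eq_0\<close> carries the relation to every parameter.\<close>

lemma csk_quadratic_iff: "csk_quadratic \<nu> \<longleftrightarrow> (\<exists>p0 p1 q. mom_defect p0 p1 q = 0)"
proof
  assume "csk_quadratic \<nu>"
  then obtain p where "degree p \<le> 2" "\<forall>m \<in> csk_means \<nu>. csk_V \<nu> m = poly p m"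
    by (auto simp: csk_quadratic_def)
  then have "cauchy_defect (coeff p 0) (coeff p 1) (coeff p 2 + 1) \<theta> = 0"
    if "\<theta> \<in> csk_params \<nu>" for \<theta>
    using that csk_V_poly_iff[OF that] by (auto simp: csk_means_def)
  then have "\<forall>\<^sub>F \<theta> in nhds 0. cauchy_defect (coeff p 0) (coeff p 1) (coeff p 2 + 1) \<theta> = 0"
    using eventually_params by (auto elim: eventually_mono)
  then show "\<exists>p0 p1 q. mom_defect p0 p1 q = 0"
    using has_fps_expansion_zero_unique[OF cauchy_defect_expansion] by blast
next
  assume "\<exists>p0 p1 q. mom_defect p0 p1 q = 0"
  then obtain p0 p1 q where *: "mom_defect p0 p1 q = 0"
    by blast
  define p where "p = [:p0, p1, q - 1:]"
  have deg: "degree p \<le> 2"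
    by (simp add: p_def)
  have "coeff p 0 = p0" "coeff p 1 = p1" "coeff p 2 + 1 = q"
    by (simp_all add: p_def numeral_2_eq_2)
  then have "csk_V \<nu> (csk_k \<nu> \<theta>) = poly p (csk_k \<nu> \<theta>)" if "\<theta> \<in> csk_params \<nu>" for \<theta>
    unfolding csk_V_poly_iff[OF that deg] using cauchy_defect_eq_0[OF * that] by simp
  then show "csk_quadratic \<nu>"
    using deg unfolding csk_quadratic_def csk_means_def by blast
qed

end

section \<open>From the generating function to the variance function\<close>

text \<open>Substitute \<open>w\<close> for \<open>fps_X\<close> in the geometric series identity;
  the zero constant term makes composition multiplicative.\<close>

lemma geometric_fps_compose:
  fixes w :: "'a::field fps"
  assumes "w $ 0 = 0"
  shows "(Abs_fps (\<lambda>k. x ^ k) oo w) * (1 - fps_const x * w) = 1"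
proof -
  have "Abs_fps (\<lambda>k. x ^ k) * (1 - fps_const x * fps_X) = 1"
  proof (rule fps_ext)
    fix n
    show "(Abs_fps (\<lambda>k. x ^ k) * (1 - fps_const x * fps_X)) $ n = 1 $ n"
      by (cases n) (simp_all add: right_diff_distrib mult.left_commute[of _ "fps_const x"] mult.assoc[symmetric])
  qed
  then have "(Abs_fps (\<lambda>k. x ^ k) * (1 - fps_const x * fps_X)) oo w = 1"
    by simp
  then show ?thesis
    using assms by (simp add: fps_compose_mult_distrib fps_compose_sub_distrib)
qed

lemma kernel_fps_unique:
  fixes w G T :: "'a::field fps"
  assumes "w $ 0 = 0" and "G $ 0 \<noteq> 0" and "T * (G * (1 - fps_const x * w)) = 1"
  shows "T = (Abs_fps (\<lambda>k. x ^ k) oo w) * inverse G"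
proof -
  let ?E = "Abs_fps (\<lambda>k. x ^ k) oo w"
  have "inverse G * G = 1"
    using assms(2) by (rule inverse_mult_eq_1)
  then show ?thesis
    using geometric_fps_compose[OF assms(1), of x] assms(3) by algebra
qed

lemma fps_compose_quad_defect:
  fixes w :: "'a::field fps"
  assumes "w $ 0 = 0"
  shows "quad_defect (fps_const p0) (fps_const p1) (fps_const q) a b c oo w
    = quad_defect (fps_const p0) (fps_const p1) (fps_const q) (a oo w) (b oo w) (c oo w)"
  using assms
  by (simp add: quad_defect_def fps_compose_sub_distrib fps_compose_add_distrib fps_compose_mult_distrib)

text \<open>The series \<open>w\<close> and \<open>G\<close> are \<open>1 / f\<close> and \<open>u f\<close>, both regular at \<open>0\<close>.\<close>

lemma cs_kernel_genfun_fps: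
  assumes "cs_kernel_genfun T"
  obtains w G :: "real fps" where "w $ 0 = 0" "w $ 1 = 1" "G $ 0 \<noteq> 0"
    "\<And>n x. poly (T n) x = ((Abs_fps (\<lambda>k. x ^ k) oo w) * inverse G) $ n"
proof -
  obtain u f U' F where U': "u has_fps_expansion U'"
    and F: "(\<lambda>z. if z = 0 then 1 else z * f z) has_fps_expansion F"
    and u_lim: "((\<lambda>z. u z / z) \<longlongrightarrow> 1) (at 0)"
    and f_lim: "((\<lambda>z. z * f z) \<longlongrightarrow> 1) (at 0)"
    and T: "\<And>x. \<forall>\<^sub>F z in at 0. (\<lambda>n. poly (T n) x * z ^ n) sums (1 / (u z * (f z - x)))"
    using assms by (auto simp: cs_kernel_genfun_def real_analytic_at_0_def)
  have "F $ 0 = 1"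
    using F by (auto simp: has_fps_expansion_def eval_fps_at_0 dest: eventually_nhds_x_imp_x)
  have "((\<lambda>z. u z / z * z) \<longlongrightarrow> 1 * 0) (at 0)"
    by (intro tendsto_intros u_lim)
  moreover have "\<forall>\<^sub>F z in at 0. u z / z * z = u z"
    by (simp add: eventually_at_filter)
  ultimately have "(u \<longlongrightarrow> 0) (at 0)"
    using Lim_transform_eventually by fastforce
  moreover have "(u \<longlongrightarrow> u 0) (at 0)"
    using has_fps_expansion_imp_continuous[OF U', of UNIV] by (simp add: continuous_within)
  ultimately have "u 0 = 0"
    by (metis LIM_unique)
  have "U' $ 0 = 0"
    using U' \<open>u 0 = 0\<close> by (auto simp: has_fps_expansion_def eval_fps_at_0 dest: eventually_nhds_x_imp_x)
  define U where "U = fps_shift 1 U'"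
  have U'_eq: "U' = fps_X * U"
    using \<open>U' $ 0 = 0\<close> by (simp add: U_def fps_eq_iff)
  \<comment> \<open>Multiplying out the kernel and cancelling one factor \<open>z\<close> of
    \<open>u\<close> turns the analytic hypothesis into an identity of power series.\<close>
  have prod: "Abs_fps (\<lambda>n. poly (T n) x) * (U * (F - fps_const x * fps_X)) = 1" for x
  proof -
    let ?T = "Abs_fps (\<lambda>n. poly (T n) x)"
    let ?F = "\<lambda>z. if z = 0 then 1 else z * f z"
    note S = sums_imp_has_fps_expansion[OF T[of x]]
    have "\<forall>\<^sub>F z in at 0. u z / z \<noteq> 0"
      by (rule tendsto_imp_eventually_ne[OF u_lim]) simp
    moreover have "((\<lambda>z. z * f z - z * x) \<longlongrightarrow> 1 - 0 * x) (at 0)"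
      by (intro tendsto_intros f_lim)
    then have "\<forall>\<^sub>F z in at 0. z * f z - z * x \<noteq> 0"
      by (rule tendsto_imp_eventually_ne) simp
    ultimately have "\<forall>\<^sub>F z in at 0. eval_fps ?T z * (u z * (?F z - x * z)) = z"
      using S(2) eventually_neq_at_within[of 0]
    proof eventually_elim
      case (elim z)
      have "?F z - x * z = z * (f z - x)"
        using elim by (simp add: algebra_simps)
      moreover have "u z \<noteq> 0" "f z - x \<noteq> 0"
        using elim by (auto simp: algebra_simps)
      ultimately show ?case
        using elim by simp
    qed
    \<comment> \<open>At \<open>z = 0\<close> both sides vanish because \<open>u 0 = 0\<close>, so
      the punctured identity holds on a full neighbourhood.\<close>
    then have "\<forall>\<^sub>F z in nhds 0. eval_fps ?T z * (u z * (?F z - x * z)) = z"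
      unfolding eventually_at_filter by eventually_elim (auto simp: \<open>u 0 = 0\<close>)
    moreover have "(\<lambda>z. eval_fps ?T z * (u z * (?F z - x * z)))
        has_fps_expansion (?T * (U' * (F - fps_const x * fps_X)))"
      by (intro has_fps_expansion_mult has_fps_expansion_diff has_fps_expansion_cmult_left
          has_fps_expansion_fps_X S(1) U' F)
    ultimately have "?T * (U' * (F - fps_const x * fps_X)) = fps_X"
      by (intro has_fps_expansion_unique[OF _ has_fps_expansion_fps_X])
    then have "fps_X * (?T * (U * (F - fps_const x * fps_X))) = fps_X * 1"
      by (simp add: U'_eq mult_ac)
    then show ?thesis
      by (subst (asm) mult_cancel_left) simp
  qed
  define w G where "w = fps_X * inverse F" and "G = U * F"
  have invF: "F * inverse F = 1"
    using \<open>F $ 0 = 1\<close> by (simp add: inverse_mult_eq_1')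
  have w01: "w $ 0 = 0" "w $ 1 = 1"
    using \<open>F $ 0 = 1\<close> by (simp_all add: w_def)
  have prod_G: "Abs_fps (\<lambda>n. poly (T n) x) * (G * (1 - fps_const x * w)) = 1" for x
    using prod[of x] invF unfolding w_def G_def by algebra
  have "(Abs_fps (\<lambda>n. poly (T n) 0) * (G * (1 - fps_const 0 * w))) $ 0 = 1"
    unfolding prod_G by simp
  then have "G $ 0 \<noteq> 0"
    by auto
  show ?thesis
  proof (rule that[OF w01 \<open>G $ 0 \<noteq> 0\<close>])
    fix n x
    show "poly (T n) x = ((Abs_fps (\<lambda>k. x ^ k) oo w) * inverse G) $ n"
      using kernel_fps_unique[OF w01(1) \<open>G $ 0 \<noteq> 0\<close> prod_G[of x]] by (metis fps_nth_Abs_fps)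
  qed
qed

context csk_law
begin

lemma integrable_poly: "integrable \<nu> (\<lambda>x. poly p x)"
  by (intro integrable_continuous continuous_intros borel_measurable_continuous_onI)

lemma integrable_power: "integrable \<nu> (\<lambda>x. x ^ k)"
  by (intro integrable_continuous continuous_intros borel_measurable_continuous_onI)

text \<open>Series form of \<open>x ^ j / (1 - \<theta> * x) = x ^ j + \<theta> * x ^ Suc j / (1 -
  \<theta> * x)\<close>, integrated.\<close>

lemma mom_Suc: "mom j = fps_const (mom j $ 0) + fps_X * mom (Suc j)"
proof (rule fps_ext)
  show "mom j $ n = (fps_const (mom j $ 0) + fps_X * mom (Suc j)) $ n" for n
    by (cases n) (simp_all add: mom_nth)
qed

lemma mom_0_0: "mom 0 $ 0 = 1"
  using prob_space by (simp add: mom_nth)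

lemma mom_1_0: "mom 1 $ 0 = 0"
  using mean_zero by (simp add: mom_nth)

lemma variance_nonzero: "mom 2 $ 0 \<noteq> 0"
proof
  assume "mom 2 $ 0 = 0"
  then have "(\<integral>x. x\<^sup>2 \<partial>\<nu>) = 0"
    by (simp add: mom_nth)
  then have "AE x in \<nu>. x\<^sup>2 = 0"
    by (subst (asm) integral_nonneg_eq_0_iff_AE) (simp_all add: integrable_power)
  then have "AE x in \<nu>. x = 0"
    by eventually_elim simp
  with not_AE_const show False by (rule notE)
qed

text \<open>Each coefficient of the kernel is a polynomial in \<open>x\<close>, so integration
  replaces powers by moments in a finite sum and no limit is exchanged.\<close>

lemma integral_kernel_coeff:
  "(\<integral>x. x ^ j * ((Abs_fps (\<lambda>k. x ^ k) oo w) * I) $ n \<partial>\<nu>) = ((mom j oo w) * I) $ n"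
proof -
  have "(\<integral>x. x ^ j * ((Abs_fps (\<lambda>k. x ^ k) oo w) * I) $ n \<partial>\<nu>)
      = (\<integral>x. (\<Sum>i=0..n. \<Sum>k=0..i. x ^ (j + k) * ((w ^ k) $ i * I $ (n - i))) \<partial>\<nu>)"
    unfolding fps_mult_nth fps_compose_nth
    by (simp add: sum_distrib_left sum_distrib_right power_add mult_ac)
  also have "\<dots> = (\<Sum>i=0..n. \<Sum>k=0..i. (\<integral>x. x ^ (j + k) \<partial>\<nu>) * ((w ^ k) $ i * I $ (n - i)))"
    by (simp add: Bochner_Integration.integral_sum integrable_power)
  also have "\<dots> = ((mom j oo w) * I) $ n"
    unfolding fps_mult_nth fps_compose_nth by (simp add: mom_nth sum_distrib_right sum_distrib_left mult_ac)
  finally show ?thesis .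
qed

text \<open>Induction on the degree: subtracting the multiple of \<open>T d\<close> with the same
  leading term lowers it. \<open>nz\<close> matters at index 0, where
  \<open>degree (T 0) = 0\<close> still allows \<open>T 0 = 0\<close>.\<close>

lemma orthogonal_lower_degree:
  assumes deg: "\<forall>n. degree (T n) = n" and orth: "orthogonal_polys \<nu> T" and nz: "\<And>n. T n \<noteq> 0"
    and "degree p < n"
  shows "(\<integral>x. poly p x * poly (T n) x \<partial>\<nu>) = 0"
  using assms(4)
proof (induction "degree p" arbitrary: p rule: less_induct)
  case less
  define d where "d = degree p"
  define c where "c = lead_coeff p / lead_coeff (T d)"
  define r where "r = p - smult c (T d)"
  have Tdn: "(\<integral>x. poly (T d) x * poly (T n) x \<partial>\<nu>) = 0"
    using orth less.prems by (auto simp: orthogonal_polys_def d_def)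
  have "(\<integral>x. poly r x * poly (T n) x \<partial>\<nu>) = 0"
  proof (cases "r = 0")
    case False
    have "degree r \<le> d"
      unfolding r_def by (intro degree_diff_le) (simp_all add: d_def deg degree_smult_le[THEN order_trans])
    moreover have "coeff (T d) d \<noteq> 0"
      using nz[of d] deg by (metis leading_coeff_0_iff)
    then have "coeff r d = 0"
      using deg by (simp add: r_def c_def d_def)
    ultimately have "degree r < d"
      using False by (metis le_neq_implies_less leading_coeff_0_iff)
    then show ?thesis
      using less.hyps[of r] less.prems by (simp add: d_def)
  qed simp
  moreover have "p = r + smult c (T d)"
    by (simp add: r_def)
  then have "(\<integral>x. poly p x * poly (T n) x \<partial>\<nu>)
      = (\<integral>x. poly r x * poly (T n) x + c * (poly (T d) x * poly (T n) x) \<partial>\<nu>)"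
    by (simp add: algebra_simps)
  moreover have "\<dots> = (\<integral>x. poly r x * poly (T n) x \<partial>\<nu>) + c * (\<integral>x. poly (T d) x * poly (T n) x \<partial>\<nu>)"
    using integrable_poly[of "r * T n"] integrable_poly[of "T d * T n"]
    by (subst Bochner_Integration.integral_add) simp_all
  ultimately show ?case
    by (simp add: Tdn)
qed

lemma quadratic_if_kernel_genfun:
  assumes deg: "\<forall>n. degree (T n) = n" and orth: "orthogonal_polys \<nu> T" and gen: "cs_kernel_genfun T"
  shows "csk_quadratic \<nu>"
proof -
  obtain w G :: "real fps" where w: "w $ 0 = 0" "w $ 1 = 1" and G: "G $ 0 \<noteq> 0"
    and T: "\<And>n x. poly (T n) x = ((Abs_fps (\<lambda>k. x ^ k) oo w) * inverse G) $ n"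
    using cs_kernel_genfun_fps[OF gen] by blast
  define P where "P j = inverse G * (mom j oo w)" for j
  have P_nth: "P j $ n = (\<integral>x. x ^ j * poly (T n) x \<partial>\<nu>)" for j n
    unfolding P_def T integral_kernel_coeff by (simp only: mult.commute)
  have nz: "T n \<noteq> 0" for n
  proof (cases "n = 0")
    case True
    have "poly (T 0) 0 \<noteq> 0"
      using G by (simp add: T)
    then show ?thesis
      using True by auto
  next
    case False
    then show ?thesis
      using deg by (metis degree_0)
  qed
  have P_0: "P j $ n = 0" if "j < n" for j n
  proof -
    have "degree (monom (1::real) j) < n"
      using that by (simp add: degree_monom_eq)
    from orthogonal_lower_degree[OF deg orth nz this] show ?thesis
      by (simp add: P_nth poly_monom)
  qed
  define \<tau> \<alpha> b0 b1 b2 where "\<tau> = P 0 $ 0" and "\<alpha> = P 1 $ 1"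
    and "b0 = P 2 $ 0" and "b1 = P 2 $ 1" and "b2 = P 2 $ 2"
  have "\<tau> \<noteq> 0"
    using G mom_0_0 by (simp add: \<tau>_def P_def)
  have "mom 1 $ 1 = mom 2 $ 0"
    by (simp add: mom_nth numeral_2_eq_2)
  \<comment> \<open>As \<open>w\<close> starts with \<open>z\<close> and the mean is 0,
    \<open>\<alpha>\<close> is the variance divided by \<open>G $ 0\<close>.\<close>
  then have "\<alpha> \<noteq> 0"
    using G variance_nonzero mom_1_0 w
    by (simp add: \<alpha>_def P_def fps_mult_nth fps_compose_nth)
  have "P 1 $ 0 = 0"
    using mom_1_0 by (simp add: P_def)
  have P0: "P 0 = fps_const \<tau>"
    using P_0[of 0] by (auto simp: fps_eq_iff \<tau>_def)
  have P1: "P 1 = fps_const \<alpha> * fps_X"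
    using P_0[of 1] \<open>P 1 $ 0 = 0\<close>
    by (auto simp: fps_eq_iff \<alpha>_def fps_X_def nat_neq_iff Suc_lessI)
  have P2: "P 2 = fps_const b0 + fps_const b1 * fps_X + fps_const b2 * fps_X\<^sup>2"
  proof (rule fps_ext)
    fix n :: nat
    consider "n = 0" | "n = 1" | "n = 2" | "2 < n"
      by linarith
    then show "P 2 $ n = (fps_const b0 + fps_const b1 * fps_X + fps_const b2 * fps_X\<^sup>2) $ n"
      by cases (simp_all add: b0_def b1_def b2_def fps_X_power_nth P_0)
  qed
  \<comment> \<open>Obtained by comparing coefficients in \<open>P 0 * P 2 = p0 * (P 0)\<^sup>2 + p1
    * P 0 * P 1 + q * (P 1)\<^sup>2\<close>.\<close>
  define p0 p1 q where "p0 = b0 / \<tau>" and "p1 = b1 / \<alpha>" and "q = \<tau> * b2 / \<alpha>\<^sup>2"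
  have p: "b0 = p0 * \<tau>" "b1 = p1 * \<alpha>" "\<tau> * b2 = q * \<alpha>\<^sup>2"
    using \<open>\<tau> \<noteq> 0\<close> \<open>\<alpha> \<noteq> 0\<close> by (simp_all add: p0_def p1_def q_def)
  have "fps_const b0 = fps_const p0 * fps_const \<tau>" "fps_const b1 = fps_const p1 * fps_const \<alpha>"
    "fps_const \<tau> * fps_const b2 = fps_const q * (fps_const \<alpha>)\<^sup>2"
    by (simp_all add: p fps_const_power)
  then have "quad_defect (fps_const p0) (fps_const p1) (fps_const q) (P 0) (P 1) (P 2) = 0"
    unfolding quad_defect_def P0 P1 P2 by algebra
  \<comment> \<open>By homogeneity the common factor \<open>inverse G\<close> comes out as a square
    and can be cancelled; composition with \<open>w\<close>, which starts with \<open>z\<close>, is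
    injective.\<close>
  then have "(inverse G)\<^sup>2 * (mom_defect p0 p1 q oo w) = 0"
    unfolding P_def quad_defect_scale fps_compose_quad_defect[OF w(1)] .
  then have "mom_defect p0 p1 q oo w = 0"
    using G by (auto simp: fps_inverse_eq_0_iff)
  then have "mom_defect p0 p1 q = 0"
    using fps_compose_eq_0_iff[OF w(1)] w(2) by auto
  then show ?thesis
    unfolding csk_quadratic_iff by blast
qed

end

section \<open>From the variance function to the generating function\<close>

text \<open>Realizes the formal generating function \<open>N / (F - x * z)\<close> by actual
  functions, with \<open>f = F / z\<close> and \<open>u = z / N\<close>.\<close>

lemma cs_kernel_genfun_rational:
  fixes a b c :: real
  defines "F \<equiv> 1 + fps_const a * fps_X + fps_const b * fps_X\<^sup>2"
    and "N \<equiv> 1 + fps_const a * fps_X + fps_const c * fps_X\<^sup>2"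
  assumes T: "\<And>x. Abs_fps (\<lambda>n. poly (T n) x) * (F - fps_const x * fps_X) = N"
  shows "cs_kernel_genfun T"
proof -
  define Fr Nr where "Fr z = 1 + a * z + b * z\<^sup>2" and "Nr z = 1 + a * z + c * z\<^sup>2" for z :: real
  have Fr: "Fr has_fps_expansion F" and Nr: "Nr has_fps_expansion N"
    unfolding F_def N_def Fr_def[abs_def] Nr_def[abs_def] by (intro fps_expansion_intros)+
  have F0: "F $ 0 = 1" and N0: "N $ 0 = 1"
    by (simp_all add: F_def N_def)
  have lim: "(Fr \<longlongrightarrow> 1) (at 0)" "(Nr \<longlongrightarrow> 1) (at 0)"
    using has_fps_expansion_imp_continuous[OF Fr, of UNIV] has_fps_expansion_imp_continuous[OF Nr, of UNIV]
    by (simp_all add: continuous_within Fr_def Nr_def)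
  define u f where "u z = z * inverse (Nr z)" and "f z = Fr z / z" for z
  have "u has_fps_expansion fps_X * inverse N"
    unfolding u_def[abs_def] using N0 by (intro fps_expansion_intros Nr) simp
  then have u: "real_analytic_at_0 u"
    by (auto simp: real_analytic_at_0_def)
  have "(\<lambda>z. if z = 0 then 1 else z * f z) = Fr"
    by (auto simp: f_def Fr_def)
  then have f: "real_analytic_at_0 (\<lambda>z. if z = 0 then 1 else z * f z)"
    using Fr by (auto simp: real_analytic_at_0_def)
  have u_lim: "((\<lambda>z. u z / z) \<longlongrightarrow> 1) (at 0)"
  proof (rule Lim_transform_eventually)
    show "((\<lambda>z. inverse (Nr z)) \<longlongrightarrow> 1) (at 0)"
      using tendsto_inverse[OF lim(2)] by simp
  qed (simp add: eventually_at_filter u_def)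
  have f_lim: "((\<lambda>z. z * f z) \<longlongrightarrow> 1) (at 0)"
    by (rule Lim_transform_eventually[OF lim(1)]) (simp add: eventually_at_filter f_def)
  have sums: "\<forall>\<^sub>F z in at 0. (\<lambda>n. poly (T n) x * z ^ n) sums (1 / (u z * (f z - x)))" for x
  proof -
    let ?T = "Abs_fps (\<lambda>n. poly (T n) x)" and ?D = "F - fps_const x * fps_X"
    have D0: "?D $ 0 \<noteq> 0"
      using F0 by simp
    have "?T = ?T * (?D * inverse ?D)"
      by (simp only: inverse_mult_eq_1'[OF D0] mult_1_right)
    also have "\<dots> = N * inverse ?D"
      by (simp only: mult.assoc[symmetric] T)
    finally have "?T = N * inverse ?D" .
    moreover have "(\<lambda>z. Nr z * inverse (Fr z - x * z)) has_fps_expansion N * inverse ?D"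
      by (intro has_fps_expansion_mult has_fps_expansion_inverse has_fps_expansion_diff
          has_fps_expansion_cmult_left has_fps_expansion_fps_X Fr Nr D0)
    ultimately have "(\<lambda>z. Nr z * inverse (Fr z - x * z)) has_fps_expansion ?T"
      by (simp only:)
    from has_fps_expansion_imp_sums[OF this]
    have "\<forall>\<^sub>F z in nhds 0. (\<lambda>n. poly (T n) x * z ^ n) sums (Nr z * inverse (Fr z - x * z))"
      by simp
    then show ?thesis
      unfolding eventually_at_filter
    proof eventually_elim
      case (elim z)
      have "1 / (u z * (f z - x)) = Nr z * inverse (Fr z - x * z)" if "z \<noteq> 0"
      proof -
        have "Fr z - x * z = z * (f z - x)"
          using that by (simp add: f_def algebra_simps)
        then show ?thesis
          by (simp add: u_def divide_inverse mult_ac)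
      qed
      then show ?case
        using elim by auto
    qed
  qed
  show ?thesis
    unfolding cs_kernel_genfun_def
    by (intro exI[of _ u] exI[of _ f] conjI allI u f u_lim f_lim sums)
qed

context csk_law
begin

lemma kernel_genfun_if_mom_defect:
  assumes "mom_defect p0 p1 q = 0"
  shows "\<exists>T :: nat \<Rightarrow> real poly.
    (\<forall>n. degree (T n) = n) \<and> orthogonal_polys \<nu> T \<and> cs_kernel_genfun T"
proof -
  define s where "s = mom 2 $ 0"
  \<comment> \<open>\<open>F\<close> and \<open>N\<close> play the roles of \<open>z * f\<close> and
    \<open>z / u\<close>. The term \<open>s * z\<^sup>2\<close> by which they differ is chosen to
    make \<open>mom 0 oo w = G\<close>, which gives \<open>P 0 = 1\<close> below.\<close>
  define F N where "F = 1 + fps_const p1 * fps_X + fps_const (q * s) * fps_X\<^sup>2"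
    and "N = 1 + fps_const p1 * fps_X + fps_const (q * s - s) * fps_X\<^sup>2"
  define w G where "w = fps_X * inverse F" and "G = F * inverse N"
  have F0: "F $ 0 = 1" and N0: "N $ 0 = 1"
    by (simp_all add: F_def N_def)
  have invF: "F * inverse F = 1" and invN: "N * inverse N = 1"
    using F0 N0 by (simp_all add: inverse_mult_eq_1')
  have w0: "w $ 0 = 0" and w1: "w $ 1 = 1" and G0: "G $ 0 = 1"
    using F0 N0 by (simp_all add: w_def G_def)
  have invG: "G * inverse G = 1"
    using G0 by (simp add: inverse_mult_eq_1')
  have wF: "w * F = fps_X"
    using invF unfolding w_def by algebra
  have GN: "G * N = F"
    using invN unfolding G_def by algebra
  have F_invG: "F * inverse G = N"
  proof -
    have "F * inverse G = (G * inverse G) * N"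
      unfolding GN[symmetric] by (simp only: mult_ac)
    then show ?thesis
      by (simp add: invG)
  qed

  \<comment> \<open>With total mass 1 and mean zero, the constant term of the relation identifies
    \<open>p0\<close> as the variance.\<close>
  have "mom_defect p0 p1 q $ 0 = s - p0"
    using mom_0_0 mom_1_0 by (simp add: quad_defect_def s_def)
  then have "p0 = s"
    using assms by simp
  define S a b c where "S = fps_const s" and "a = mom 0 oo w" and "b = mom 1 oo w" and "c = mom 2 oo w"
  have "mom 0 = 1 + fps_X * mom 1" "mom 1 = fps_X * mom 2"
    using mom_Suc[of 0] mom_Suc[of 1] mom_0_0 mom_1_0 by (simp_all add: numeral_2_eq_2)
  then have "a = (1 + fps_X * mom 1) oo w" "b = (fps_X * mom 2) oo w"
    unfolding a_def b_def by simp_all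
  then have a: "a = 1 + w * b" and b: "b = w * c"
    using w0 by (simp_all add: b_def c_def fps_compose_add_distrib fps_compose_mult_distrib)
  have "quad_defect S (fps_const p1) (fps_const q) a b c = 0"
    using assms fps_compose_quad_defect[OF w0, of p0 p1 q "mom 0" "mom 1" "mom 2"]
    by (simp add: a_def b_def c_def S_def \<open>p0 = s\<close>)
  then have abc: "a * c = S * (a * a) + fps_const p1 * (a * b) + fps_const q * (b * b)"
    by (simp add: quad_defect_def)
  have wF': "w * (1 + fps_const p1 * fps_X + fps_const q * S * fps_X\<^sup>2) = fps_X"
    using wF by (simp add: F_def S_def)
  text \<open>
    Both \<open>b\<close> and \<open>S z a\<close> solve \<open>y a = w (S a\<^sup>2 + p\<^sub>1 a y + q y\<^sup>2)\<close>, whose solution is unique.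
  \<close>
  define d where "d = b - S * fps_X * a"
  have "d * (a - w * (fps_const p1 * a + fps_const q * (b + S * fps_X * a))) = 0"
    using abc b wF' unfolding d_def by algebra
  moreover have "(a - w * (fps_const p1 * a + fps_const q * (b + S * fps_X * a))) $ 0 = 1"
    using w0 mom_0_0 by (simp add: a_def)
  then have "a - w * (fps_const p1 * a + fps_const q * (b + S * fps_X * a)) \<noteq> 0"
    by (metis fps_zero_nth zero_neq_one)
  ultimately have "b = S * fps_X * a"
    by (simp add: d_def)
  have "N = F - S * fps_X\<^sup>2"
  proof -
    have "fps_const (q * s - s) = fps_const (q * s) - S"
      by (simp add: S_def)
    then show ?thesis
      by (simp only: N_def F_def left_diff_distrib add_diff_eq)
  qed
  \<comment> \<open>Eliminating \<open>b\<close> from \<open>a = 1 + w * b\<close> gives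
    \<open>a * (1 - S * fps_X * w) = 1\<close>; multiply by \<open>F\<close> and use
    \<open>w * F = fps_X\<close>.\<close>
  then have "a * N = F"
    using a \<open>b = S * fps_X * a\<close> wF by algebra
  then have "a = G"
    using GN N0 by (metis fps_zero_nth mult_right_cancel zero_neq_one)

  \<comment> \<open>Degree bound for the transformed moment series\<close>
  define P where "P j = (mom j oo w) * inverse G" for j
  have P0: "P 0 = 1"
    using \<open>a = G\<close> invG by (simp add: P_def a_def)
  have P_Suc: "fps_X * P (Suc j) = F * P j - fps_const (mom j $ 0) * N" for j
  proof -
    have "mom j oo w = (fps_const (mom j $ 0) + fps_X * mom (Suc j)) oo w"
      by (rule arg_cong[OF mom_Suc])
    then have "mom j oo w = fps_const (mom j $ 0) + w * (mom (Suc j) oo w)"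
      using w0 by (simp add: fps_compose_add_distrib fps_compose_mult_distrib)
    then show ?thesis
      using wF F_invG unfolding P_def by algebra
  qed
  \<comment> \<open>The recurrence multiplies by a quadratic and divides by \<open>z\<close>, so the
    degree grows by at most one; the \<open>N\<close> term drops out because
    \<open>n \<ge> 2\<close> puts \<open>Suc n\<close> beyond its degree.\<close>
  have P_nth: "P j $ n = 0" if "j < n" for j n
    using that
  proof (induction j arbitrary: n)
    case 0
    then show ?case by (simp add: P0)
  next
    case (Suc j)
    then have "2 \<le> n"
      by simp
    then obtain m where n: "n = Suc (Suc m)"
      by (metis add_2_eq_Suc le_Suc_ex)
    have "P (Suc j) $ n = (fps_X * P (Suc j)) $ Suc n"
      by simp
    also have "\<dots> = (F * P j) $ Suc n - mom j $ 0 * N $ Suc n"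
      by (simp add: P_Suc)
    also have "(F * P j) $ Suc n = P j $ Suc n + p1 * P j $ n + q * s * P j $ (n - 1)"
      by (simp add: F_def distrib_right mult.assoc fps_X_power_mult_nth n)
    also have "N $ Suc n = 0"
      by (simp add: N_def fps_X_power_nth n)
    finally show ?case
      using Suc n by simp
  qed

  \<comment> \<open>The orthogonal polynomials read off from the kernel\<close>
  define T where
    "T n = (\<Sum>i=0..n. \<Sum>k=0..i. monom ((w ^ k) $ i * inverse G $ (n - i)) k)" for n
  have poly_T: "poly (T n) x = ((Abs_fps (\<lambda>k. x ^ k) oo w) * inverse G) $ n" for n x
    unfolding fps_mult_nth fps_compose_nth
    by (simp add: T_def poly_sum poly_monom sum_distrib_left sum_distrib_right mult_ac)
  have deg: "degree (T n) = n" for n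
  proof (rule antisym)
    show "degree (T n) \<le> n"
      unfolding T_def
      by (intro degree_sum_le finite_atLeastAtMost order_trans[OF degree_monom_le]) simp
    \<comment> \<open>Since \<open>k \<le> i \<le> n\<close>, only \<open>i = k = n\<close>
      contributes to the coefficient of \<open>x ^ n\<close>, and
      \<open>(w ^ n) $ n = 1\<close>.\<close>
    have "coeff (T n) n = (\<Sum>i=0..n. if i = n then (w ^ n) $ n * inverse G $ 0 else 0)"
      unfolding T_def coeff_sum by (intro sum.cong) (auto simp: sum.delta)
    also have "\<dots> = 1"
      using startsby_zero_power_nth_same[OF w0, of n] w1 G0 by simp
    finally show "n \<le> degree (T n)"
      by (intro le_degree) simp
  qed
  have moment_T: "(\<integral>x. x ^ j * poly (T n) x \<partial>\<nu>) = 0" if "j < n" for j n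
    using P_nth[OF that] unfolding poly_T integral_kernel_coeff P_def .
  have orth: "(\<integral>x. poly (T n) x * poly (T k) x \<partial>\<nu>) = 0" if "k < n" for n k
  proof -
    have "(\<integral>x. poly (T n) x * poly (T k) x \<partial>\<nu>)
        = (\<integral>x. (\<Sum>i\<le>k. coeff (T k) i * (x ^ i * poly (T n) x)) \<partial>\<nu>)"
      by (simp add: poly_altdef[of "T k"] deg sum_distrib_left sum_distrib_right mult_ac)
    also have "\<dots> = (\<Sum>i\<le>k. \<integral>x. coeff (T k) i * (x ^ i * poly (T n) x) \<partial>\<nu>)"
    proof (rule Bochner_Integration.integral_sum)
      show "integrable \<nu> (\<lambda>x. coeff (T k) i * (x ^ i * poly (T n) x))" for i
        using integrable_poly[of "smult (coeff (T k) i) (monom 1 i * T n)"] by (simp add: poly_monom)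
    qed
    also have "\<dots> = 0"
      using that by (intro sum.neutral) (simp add: moment_T)
    finally show ?thesis .
  qed
  have "orthogonal_polys \<nu> T"
    unfolding orthogonal_polys_def
  proof (intro allI impI)
    fix n k :: nat
    assume "n \<noteq> k"
    then consider "k < n" | "n < k"
      by linarith
    then show "(\<integral>x. poly (T n) x * poly (T k) x \<partial>\<nu>) = 0"
    proof cases
      case 1
      then show ?thesis by (rule orth)
    next
      case 2
      from orth[OF this] show ?thesis by (simp only: mult.commute)
    qed
  qed
  moreover have "cs_kernel_genfun T"
  proof (rule cs_kernel_genfun_rational)
    fix x
    let ?E = "Abs_fps (\<lambda>k. x ^ k) oo w"
    have "Abs_fps (\<lambda>n. poly (T n) x) = ?E * inverse G"
      by (rule fps_ext) (simp add: poly_T)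
    \<comment> \<open>\<open>w * F = fps_X\<close> factors \<open>F - x * fps_X\<close> as
      \<open>F * (1 - x * w)\<close>, which cancels the geometric factor.\<close>
    moreover have "?E * inverse G * (F - fps_const x * fps_X)
        = (?E * (1 - fps_const x * w)) * (F * inverse G)"
      unfolding wF[symmetric] by (simp only: algebra_simps mult_1_right mult_1_left)
    ultimately show "Abs_fps (\<lambda>n. poly (T n) x)
        * (1 + fps_const p1 * fps_X + fps_const (q * s) * fps_X\<^sup>2 - fps_const x * fps_X)
      = 1 + fps_const p1 * fps_X + fps_const (q * s - s) * fps_X\<^sup>2"
      unfolding geometric_fps_compose[OF w0] F_invG by (simp only: F_def N_def mult_1_left)
  qed
  ultimately show ?thesis
    using deg by blast
qed

end

theorem corollary3p5:
  fixes \<nu> :: "real measure"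
  assumes "real_distribution \<nu>"
    and "compact (msupport \<nu>)"
    and "nondegenerate \<nu>"
    and "(\<integral>x. x \<partial>\<nu>) = 0"
  shows "(\<exists>T :: nat \<Rightarrow> real poly.
            (\<forall>n. degree (T n) = n) \<and> orthogonal_polys \<nu> T \<and> cs_kernel_genfun T)
         \<longleftrightarrow> csk_quadratic \<nu>"
proof -
  interpret csk_law \<nu> "csk_A \<nu>" "csk_B \<nu>"
    using assms by (rule csk_law_of_compact_msupport)
  show ?thesis
    using quadratic_if_kernel_genfun kernel_genfun_if_mom_defect csk_quadratic_iff by blast
qed

end
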